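(* For $n\ge1$ let $S_n(132)$ be the set of $132$-avoiding permutations of $\{1,\dots,n\}$, and for $\sigma=\sigma_1\cdots\sigma_n$ let $\mathrm{box}(\sigma)$ be the number of indices $i$ such that $|\sigma_i-\sigma_{i+1}|=1$ or $|\sigma_{i-1}-\sigma_i|=1$ (ignoring nonexistent entries). Let $A_0(x)=1$, $A_n(x)=\sum_{\sigma\in S_n(132)}x^{\mathrm{box}(\sigma)}$, $B_n(x)=\sum_{\sigma\in S_n(132),\sigma_1=n}x^{\mathrm{box}(\sigma)}$ and $E_n(x)=\sum_{\sigma\in S_n(132),\sigma_n=n}x^{\mathrm{box}(\sigma)}$ for $n\ge1$, and let $A(t,x)=\sum_{n\ge0}A_n(x)t^n$, $B(t,x)=\sum_{n\ge1}B_n(x)t^n$, $E(t,x)=\sum_{n\ge1}E_n(x)t^n$. Then $$A(t,x)=\frac{1+t+t^2-tx-t^2x-t^3x+t^3x^2-\sqrt{F(t,x)}}{2\big(t(1-xt)+x^2t^2\big)},$$ where $F(t,x)=(1+t+t^2-tx-t^2x-t^3x+t^3x^2)^2-4\big((1+t)(1-xt)+x^2t^2\big)\big(t(1-xt)+x^2t^2\big)$, and $$B(t,x)=E(t,x)=\frac{t(1-xt)+x^2t^2}{(1+t)(1-xt)+x^2t^2}\,A(t,x).$$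
   Context: A permutation $\sigma\in S_n$ avoids $132$ if there are no indices $i<j<k$ with $\sigma_i<\sigma_k<\sigma_j$. The square root is the branch making $A(t,x)$ a formal power series in $t$ with constant term $1$. *)

theory Defs
  imports
    "HOL-Computational_Algebra.Computational_Algebra"
    "HOL-Combinatorics.Multiset_Permutations"
begin

text \<open>Permutations are written in one-line notation, as lists with positions \<open>0, \<dots>, n - 1\<close>.\<close>

definition avoids132 :: "nat list \<Rightarrow> bool" where
  "avoids132 \<sigma> \<longleftrightarrow>
     \<not> (\<exists>i j k. i < j \<and> j < k \<and> k < length \<sigma> \<and> \<sigma> ! i < \<sigma> ! k \<and> \<sigma> ! k < \<sigma> ! j)"

definition S132 :: "nat \<Rightarrow> nat list set" where
  "S132 n = {\<sigma> \<in> permutations_of_set {1..n}. avoids132 \<sigma>}"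

definition box :: "nat list \<Rightarrow> nat" where
  "box \<sigma> = card {i. i < length \<sigma> \<and>
     ((i + 1 < length \<sigma> \<and> \<bar>int (\<sigma> ! i) - int (\<sigma> ! (i + 1))\<bar> = 1) \<or>
      (i \<ge> 1 \<and> \<bar>int (\<sigma> ! (i - 1)) - int (\<sigma> ! i)\<bar> = 1))}"

definition A_poly :: "nat \<Rightarrow> int poly" where
  "A_poly n = (if n = 0 then 1 else (\<Sum>\<sigma>\<in>S132 n. [:0, 1:] ^ box \<sigma>))"

definition B_poly :: "nat \<Rightarrow> int poly" where
  "B_poly n = (\<Sum>\<sigma>\<in>{\<sigma> \<in> S132 n. hd \<sigma> = n}. [:0, 1:] ^ box \<sigma>)"

definition E_poly :: "nat \<Rightarrow> int poly" where
  "E_poly n = (\<Sum>\<sigma>\<in>{\<sigma> \<in> S132 n. last \<sigma> = n}. [:0, 1:] ^ box \<sigma>)"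

text \<open>
  The generating functions have coefficients in \<open>\<int>[x]\<close>. They are viewed as power series in
  \<open>t\<close> over the fraction field \<open>\<rat>(x)\<close>, where the division of power series is
  available: it is exact whenever the quotient exists as a power series, even if
  the denominator is not a unit.
\<close>

type_synonym qx_fps = "int poly fract fps"

definition A_gf :: qx_fps where
  "A_gf = Abs_fps (\<lambda>n. to_fract (A_poly n))"

definition B_gf :: qx_fps where
  "B_gf = Abs_fps (\<lambda>n. if n = 0 then 0 else to_fract (B_poly n))"

definition E_gf :: qx_fps where
  "E_gf = Abs_fps (\<lambda>n. if n = 0 then 0 else to_fract (E_poly n))"

abbreviation T :: qx_fps where
  "T \<equiv> fps_X"

definition X :: qx_fps where
  "X = fps_const (to_fract [:0, 1:])"

definition F_gf :: qx_fps where
  "F_gf = (1 + T + T^2 - T*X - T^2*X - T^3*X + T^3*X^2)^2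
       - 4 * ((1 + T)*(1 - X*T) + X^2*T^2) * (T*(1 - X*T) + X^2*T^2)"

text \<open>
  Square root of a power series with constant term \<open>1\<close>, in the branch with constant
  term \<open>1\<close>.
\<close>

definition fps_sqrt :: "'a::field_char_0 fps \<Rightarrow> 'a fps" where
  "fps_sqrt f = fps_radical (\<lambda>_ _. 1) 2 f"

lemma fps_sqrt_iff:
  fixes f s :: "'a::field_char_0 fps"
  assumes "f $ 0 = 1"
  shows "s = fps_sqrt f \<longleftrightarrow> s^2 = f \<and> s $ 0 = 1"
proof -
  let ?r = "\<lambda>(_::nat) (_::'a). 1::'a"
  have *: "s^2 = f \<longleftrightarrow> s = fps_sqrt f" if "s $ 0 = 1" for s
    using radical_unique[of ?r 1 f s] assms that
    by (simp add: fps_sqrt_def numeral_2_eq_2)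
  have "fps_sqrt f $ 0 = 1"
    by (simp add: fps_sqrt_def)
  with * show ?thesis by blast
qed

lemma F_gf_nth_0: "F_gf $ 0 = 1"
  by (simp add: F_gf_def X_def fps_nth_power_0)

text \<open>
  This is the branch that makes the formula for \<open>A_gf\<close> a power series: already the
  existence of a power series quotient determines the square root of \<open>F_gf\<close>.
\<close>

lemma fps_sqrt_F_branch:
  assumes "s^2 = F_gf"
    and "2 * (T*(1 - X*T) + X^2*T^2) * a
           = 1 + T + T^2 - T*X - T^2*X - T^3*X + T^3*X^2 - s"
  shows "s = fps_sqrt F_gf"
proof -
  have "(2 * (T*(1 - X*T) + X^2*T^2) * a) $ 0 = 0"
    by (simp add: X_def)
  then have "s $ 0 = 1"
    unfolding assms(2) by (simp add: X_def)
  then show ?thesis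
    using assms(1) F_gf_nth_0 by (simp add: fps_sqrt_iff)
qed

end

theory Submission
  imports Defs
begin

text \<open>
  A 132-avoiding permutation splits at its maximum as \<open>L n R\<close>, where every entry of \<open>L\<close>
  exceeds every entry of \<open>R\<close>. If \<open>L\<close> is nonempty, then \<open>n\<close> is not adjacent in value to the
  first entry of \<open>R\<close>, so the box statistic is additive over \<open>L n\<close> and \<open>R\<close>; this gives
  \<open>A = 1 + B + (E - t) A\<close>. Attaching a new maximum at one end raises the box statistic by
  \<open>0\<close>, \<open>1\<close> or \<open>2\<close>, depending on whether the permutation, and what is left of it after
  removing its own maximum, has its maximum at this end. This is a linear recurrence, the
  same for both ends, which determines \<open>B\<close> and \<open>E\<close> from \<open>A\<close>. Eliminating \<open>B\<close> and \<open>E\<close>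
  leaves a quadratic equation for \<open>A\<close>.
\<close>

section \<open>Avoidance of 132\<close>

lemma avoids132_Nil [simp]: "avoids132 []"
  by (simp add: avoids132_def)

text \<open>The first entry of a list can only be the smallest element of a 132 pattern, so only
  pairs of later entries have to be tested against it. \<open>sorted_wrt\<close> ranges over exactly
  these pairs and makes list induction possible.\<close>

lemma avoids132_Cons:
  "avoids132 (a # xs) \<longleftrightarrow> sorted_wrt (\<lambda>b c. \<not> (a < c \<and> c < b)) xs \<and> avoids132 xs"
  (is "_ \<longleftrightarrow> ?R")
proof
  assume "avoids132 (a # xs)"
  then have H: False if "i < j" "j < k" "k < length (a # xs)"
      "(a # xs) ! i < (a # xs) ! k" "(a # xs) ! k < (a # xs) ! j" for i j k
    using that unfolding avoids132_def by blast
  have "\<not> (a < xs ! k \<and> xs ! k < xs ! j)" if "j < k" "k < length xs" for j k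
    using H[of 0 "Suc j" "Suc k"] that by auto
  moreover have "avoids132 xs"
    unfolding avoids132_def
  proof (intro notI, elim exE conjE)
    fix i j k assume "i < j" "j < k" "k < length xs" "xs ! i < xs ! k" "xs ! k < xs ! j"
    with H[of "Suc i" "Suc j" "Suc k"] show False by auto
  qed
  ultimately show ?R by (auto simp: sorted_wrt_iff_nth_less)
next
  assume h: ?R
  show "avoids132 (a # xs)"
    unfolding avoids132_def
  proof (intro notI, elim exE conjE)
    fix i j k assume *: "i < j" "j < k" "k < length (a # xs)"
      "(a # xs) ! i < (a # xs) ! k" "(a # xs) ! k < (a # xs) ! j"
    obtain j' k' where jk: "j = Suc j'" "k = Suc k'"
      using * by (metis less_zeroE not0_implies_Suc)
    show False
    proof (cases i)
      case 0
      with * jk h show False by (auto simp: sorted_wrt_iff_nth_less)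
    next
      case (Suc i')
      with * jk h show False by (auto simp: avoids132_def)
    qed
  qed
qed

lemma avoids132_map_add [simp]: "avoids132 (map ((+) c) xs) \<longleftrightarrow> avoids132 xs"
  by (induction xs) (auto simp: avoids132_Cons sorted_wrt_map)

lemma sorted_wrtI: "(\<And>b c. c \<in> set xs \<Longrightarrow> P b c) \<Longrightarrow> sorted_wrt P xs"
  by (induction xs) auto

text \<open>A strict maximum can only be the 3 of a pattern, with its 1 in \<open>xs\<close> and its
  2 in \<open>ys\<close>; the condition y \<le> x forbids this. It also rules out every other
  pattern meeting both \<open>xs\<close> and \<open>ys\<close>, since the 1 would lie in
  \<open>xs\<close> and the 2 in \<open>ys\<close>.\<close>

lemma avoids132_split_max:
  assumes "\<forall>x\<in>set xs. x < m" "\<forall>y\<in>set ys. y < m"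
  shows "avoids132 (xs @ m # ys) \<longleftrightarrow>
    avoids132 xs \<and> avoids132 ys \<and> (\<forall>x\<in>set xs. \<forall>y\<in>set ys. y \<le> x)"
  using assms
proof (induction xs)
  case Nil
  have "sorted_wrt (\<lambda>b c. \<not> (m < c \<and> c < b)) ys"
  proof (rule sorted_wrtI)
    fix b c assume "c \<in> set ys"
    with Nil show "\<not> (m < c \<and> c < b)" by auto
  qed
  then show ?case by (simp add: avoids132_Cons)
next
  case (Cons a xs)
  let ?P = "\<lambda>b c. \<not> (a < c \<and> c < b)"
  have IH: "avoids132 (xs @ m # ys) \<longleftrightarrow>
      avoids132 xs \<and> avoids132 ys \<and> (\<forall>x\<in>set xs. \<forall>y\<in>set ys. y \<le> x)"
    using Cons by simp
  have "sorted_wrt ?P ys" if "\<forall>y\<in>set ys. y \<le> a"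
  proof (rule sorted_wrtI)
    fix b c assume "c \<in> set ys"
    with that show "?P b c" by (simp add: leD)
  qed
  moreover have "y \<le> a" if "y \<in> set ys" "sorted_wrt ?P (xs @ m # ys)" for y
    using that Cons.prems(2) by (auto simp: sorted_wrt_append)
  moreover have "?P x m" if "x \<in> set xs" for x
    using that Cons.prems(1) by auto
  ultimately have "sorted_wrt ?P (xs @ m # ys) \<longleftrightarrow>
      sorted_wrt ?P xs \<and> (\<forall>y\<in>set ys. y \<le> a)"
    by (fastforce simp: sorted_wrt_append)
  with IH show ?case by (auto simp: avoids132_Cons)
qed

section \<open>The box statistic\<close>

definition adj :: "nat \<Rightarrow> nat \<Rightarrow> bool" where
  "adj a b \<longleftrightarrow> \<bar>int a - int b\<bar> = 1"

lemma adj_commute: "adj a b \<longleftrightarrow> adj b a"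
  by (auto simp: adj_def)

lemma adj_Suc [simp]: "adj a (Suc a)" "adj (Suc a) a"
  by (auto simp: adj_def)

definition box_set :: "nat list \<Rightarrow> nat set" where
  "box_set xs = {i. i < length xs \<and> ((i + 1 < length xs \<and> adj (xs ! i) (xs ! (i + 1))) \<or>
     (i \<ge> 1 \<and> adj (xs ! (i - 1)) (xs ! i)))}"

lemma box_eq_card: "box xs = card (box_set xs)"
  by (simp add: box_def box_set_def adj_def)

lemma finite_box_set [simp]: "finite (box_set xs)"
  by (simp add: box_set_def)

lemma box_set_less: "i \<in> box_set xs \<Longrightarrow> i < length xs"
  by (simp add: box_set_def)

lemma box_Nil [simp]: "box [] = 0"
  by (simp add: box_def)

lemma box_singleton [simp]: "box [a] = 0"
  by (simp add: box_def)

lemma box_pair: "adj a b \<Longrightarrow> box [a, b] = 2"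
proof -
  assume "adj a b"
  then have "box_set [a, b] = {0, 1}"
    by (auto simp: box_set_def less_Suc_eq)
  then show ?thesis by (simp add: box_eq_card)
qed

lemma box_map_add [simp]: "box (map ((+) c) xs) = box xs"
proof -
  have "box_set (map ((+) c) xs) = box_set xs"
    by (auto simp: box_set_def adj_def)
  then show ?thesis by (simp add: box_eq_card)
qed

text \<open>Reversing positions preserves neighbours, and it embeds the box set of a list into that
  of its reverse. Used for \<open>xs\<close> and for \<open>rev xs\<close>, this gives both
  inequalities of cardinalities. The symmetry carries \<open>box_snoc_adj\<close> over to the front
  of a list.\<close>

lemma box_rev: "box (rev xs) = box xs"
proof -
  let ?r = "\<lambda>i. length xs - Suc i"
  have sub: "?r ` box_set ys \<subseteq> box_set (rev ys)" if len: "length ys = length xs" for ys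
  proof
    fix i assume "i \<in> ?r ` box_set ys"
    then obtain j where j: "j \<in> box_set ys" "i = length ys - Suc j"
      using len by auto
    then have "j < length ys" by (simp add: box_set_less)
    then have rj: "rev ys ! i = ys ! j" using j by (simp add: rev_nth)
    from j(1) consider "j + 1 < length ys" "adj (ys ! j) (ys ! (j + 1))"
      | "j \<ge> 1" "adj (ys ! (j - 1)) (ys ! j)"
      by (auto simp: box_set_def)
    then show "i \<in> box_set (rev ys)"
    proof cases
      case 1
      then have "rev ys ! (i - 1) = ys ! (j + 1)"
        using j by (simp add: rev_nth Suc_diff_Suc)
      with 1 j rj show ?thesis by (auto simp: box_set_def adj_commute)
    next
      case 2
      then have "rev ys ! (i + 1) = ys ! (j - 1)"
        using j \<open>j < length ys\<close> by (simp add: rev_nth Suc_diff_Suc)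
      with 2 j rj \<open>j < length ys\<close> show ?thesis by (auto simp: box_set_def adj_commute)
    qed
  qed
  have inj: "inj_on ?r (box_set ys)" if "length ys = length xs" for ys
    using that by (auto intro!: inj_onI dest!: box_set_less)
  have "card (box_set ys) \<le> card (box_set (rev ys))" if "length ys = length xs" for ys
    using card_mono[OF finite_box_set sub[OF that]] card_image[OF inj[OF that]] by simp
  from this[of xs] this[of "rev xs"] show ?thesis
    by (simp add: box_eq_card)
qed

text \<open>Without an adjacency across the seam no entry gains a relevant neighbour, so the box set
  is the disjoint union of that of \<open>xs\<close> and the shifted one of
  \<open>ys\<close>.\<close>

lemma box_append:
  assumes "xs = [] \<or> ys = [] \<or> \<not> adj (last xs) (hd ys)"
  shows "box (xs @ ys) = box xs + box ys"
proof (cases "xs = [] \<or> ys = []")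
  case True
  then show ?thesis by auto
next
  case False
  with assms have ne: "xs \<noteq> []" "ys \<noteq> []" and
    na: "\<not> adj (xs ! (length xs - 1)) (ys ! 0)"
    by (auto simp: last_conv_nth hd_conv_nth)
  have 1: "i \<in> box_set (xs @ ys) \<longleftrightarrow> i \<in> box_set xs" if "i < length xs" for i
  \<comment> \<open>Only the last position of \<open>xs\<close> sees the seam.\<close>
  proof (cases "i + 1 = length xs")
    case True
    then have "xs ! i = xs ! (length xs - 1)" by (metis add_diff_cancel_right')
    with True na that show ?thesis by (auto simp: box_set_def nth_append)
  next
    case False
    with that show ?thesis by (auto simp: box_set_def nth_append)
  qed
  have 2: "length xs + i \<in> box_set (xs @ ys) \<longleftrightarrow> i \<in> box_set ys" for i
  proof (cases i)
    case 0
    with na ne show ?thesis by (auto simp: box_set_def nth_append)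
  next
    case (Suc j)
    then show ?thesis by (auto simp: box_set_def nth_append)
  qed
  have "box_set (xs @ ys) = box_set xs \<union> (+) (length xs) ` box_set ys"
  proof (intro set_eqI)
    fix i
    show "i \<in> box_set (xs @ ys) \<longleftrightarrow> i \<in> box_set xs \<union> (+) (length xs) ` box_set ys"
    proof (cases "i < length xs")
      case True
      then show ?thesis using 1 by auto
    next
      case False
      then obtain j where "i = length xs + j" by (metis le_Suc_ex not_less)
      then show ?thesis using 2[of j] by (auto dest: box_set_less)
    qed
  qed
  moreover have "box_set xs \<inter> (+) (length xs) ` box_set ys = {}"
    by (auto dest: box_set_less)
  ultimately show ?thesis
    by (simp add: box_eq_card card_Un_disjoint card_image)
qed

text \<open>The entry \<open>b\<close> is already counted because of \<open>a\<close>, so only the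
  position of \<open>c\<close> is new.\<close>

lemma box_snoc_adj:
  assumes "adj a b" "adj b c"
  shows "box (xs @ [a, b, c]) = Suc (box (xs @ [a, b]))"
proof -
  let ?n = "length xs"
  have "i \<in> box_set (xs @ [a, b, c]) \<longleftrightarrow> i = Suc (Suc ?n) \<or> i \<in> box_set (xs @ [a, b])" for i
  proof -
    consider "i < ?n" | "i = ?n" | "i = Suc ?n" | "i = Suc (Suc ?n)" | "i > Suc (Suc ?n)"
      by linarith
    then show ?thesis
      using assms by cases (auto simp: box_set_def nth_append less_Suc_eq)
  qed
  then have "box_set (xs @ [a, b, c]) = insert (Suc (Suc ?n)) (box_set (xs @ [a, b]))"
    by auto
  moreover have "Suc (Suc ?n) \<notin> box_set (xs @ [a, b])"
    by (auto dest: box_set_less)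
  ultimately show ?thesis by (simp add: box_eq_card)
qed

lemma box_Cons_adj:
  assumes "adj a b" "adj b c"
  shows "box (c # b # a # xs) = Suc (box (b # a # xs))"
  using box_snoc_adj[OF assms, of "rev xs"] box_rev[of "c # b # a # xs"] box_rev[of "b # a # xs"]
  by simp

section \<open>Attaching a new maximum\<close>

lemma S132_iff:
  "\<sigma> \<in> S132 n \<longleftrightarrow> set \<sigma> = {1..n} \<and> distinct \<sigma> \<and> avoids132 \<sigma>"
  by (auto simp: S132_def permutations_of_set_def)

lemma S132_length: "\<sigma> \<in> S132 n \<Longrightarrow> length \<sigma> = n"
  by (metis S132_iff card_atLeastAtMost diff_Suc_1 distinct_card)

lemma finite_S132 [simp]: "finite (S132 n)"
  by (simp add: S132_def)

lemma S132_0 [simp]: "S132 0 = {[]}"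
  by (auto simp: S132_iff)

lemma set_insert_maxD:
  assumes "insert (Suc n) A = {1..Suc n}" "Suc n \<notin> A"
  shows "A = {1..n}"
proof -
  have "A = {1..Suc n} - {Suc n}" using assms by blast
  then show ?thesis by auto
qed

text \<open>This is the common core of attaching a maximum at either end. The last hypothesis may
  assume that the entries of \<open>ys\<close> are at most \<open>n\<close>, which is what
  \<open>avoids132_split_max\<close> requires.\<close>

lemma S132_Suc_iff:
  assumes "set xs = insert (Suc n) (set ys)"
    and "distinct xs \<longleftrightarrow> Suc n \<notin> set ys \<and> distinct ys"
    and "set ys = {1..n} \<Longrightarrow> avoids132 xs \<longleftrightarrow> avoids132 ys"
  shows "xs \<in> S132 (Suc n) \<longleftrightarrow> ys \<in> S132 n"
proof
  assume xs: "xs \<in> S132 (Suc n)"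
  then have ys: "Suc n \<notin> set ys" "distinct ys" "insert (Suc n) (set ys) = {1..Suc n}"
    using assms(1,2) unfolding S132_iff by metis+
  from ys(3,1) have "set ys = {1..n}" by (rule set_insert_maxD)
  with xs ys assms(3) show "ys \<in> S132 n" unfolding S132_iff by metis
next
  assume ys: "ys \<in> S132 n"
  then have eq: "set ys = {1..n}" unfolding S132_iff by metis
  then have "Suc n \<notin> set ys" by simp
  moreover have "insert (Suc n) {1..n} = {1..Suc n}" by auto
  ultimately show "xs \<in> S132 (Suc n)"
    using ys eq assms unfolding S132_iff by metis
qed

lemma S132_Suc_snoc: "L @ [Suc n] \<in> S132 (Suc n) \<longleftrightarrow> L \<in> S132 n"
  using avoids132_split_max[of L "Suc n" "[]"] by (intro S132_Suc_iff) auto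

lemma S132_Suc_Cons: "Suc n # R \<in> S132 (Suc n) \<longleftrightarrow> R \<in> S132 n"
  using avoids132_split_max[of "[]" "Suc n" R] by (intro S132_Suc_iff) auto

lemma S132_Suc_nonempty: "\<sigma> \<in> S132 (Suc n) \<Longrightarrow> \<sigma> \<noteq> []"
  using S132_length by fastforce

lemma S132_last_max:
  "{\<sigma> \<in> S132 (Suc n). last \<sigma> = Suc n} = (\<lambda>L. L @ [Suc n]) ` S132 n"
proof (intro equalityI subsetI)
  fix \<sigma> assume a: "\<sigma> \<in> {\<sigma> \<in> S132 (Suc n). last \<sigma> = Suc n}"
  then have "\<sigma> = butlast \<sigma> @ [Suc n]"
    using append_butlast_last_id[OF S132_Suc_nonempty] by force
  with a show "\<sigma> \<in> (\<lambda>L. L @ [Suc n]) ` S132 n"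
    using S132_Suc_snoc by (metis (no_types, lifting) image_eqI mem_Collect_eq)
qed (auto simp: S132_Suc_snoc)

lemma S132_hd_max:
  "{\<sigma> \<in> S132 (Suc n). hd \<sigma> = Suc n} = (#) (Suc n) ` S132 n"
proof (intro equalityI subsetI)
  fix \<sigma> assume a: "\<sigma> \<in> {\<sigma> \<in> S132 (Suc n). hd \<sigma> = Suc n}"
  then have "\<sigma> = Suc n # tl \<sigma>"
    using list.collapse[OF S132_Suc_nonempty] by force
  with a show "\<sigma> \<in> (#) (Suc n) ` S132 n"
    using S132_Suc_Cons by (metis (no_types, lifting) image_eqI mem_Collect_eq)
qed (auto simp: S132_Suc_Cons)

section \<open>Weighted sums and the recurrence for permutations with their maximum at one
  end\<close>

abbreviation weight :: "nat list \<Rightarrow> int poly" where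
  "weight \<sigma> \<equiv> [:0, 1:] ^ box \<sigma>"

lemma A_poly_eq: "A_poly n = (\<Sum>\<sigma>\<in>S132 n. weight \<sigma>)"
  by (simp add: A_poly_def)

lemma E_poly_Suc: "E_poly (Suc n) = (\<Sum>L\<in>S132 n. weight (L @ [Suc n]))"
  unfolding E_poly_def S132_last_max by (subst sum.reindex) (auto simp: inj_on_def)

lemma B_poly_Suc: "B_poly (Suc n) = (\<Sum>R\<in>S132 n. weight (Suc n # R))"
  unfolding B_poly_def S132_hd_max by (subst sum.reindex) (auto simp: inj_on_def)

text \<open>This treats both ends at once: \<open>C m L\<close> attaches \<open>m\<close> to
  \<open>L\<close> at a fixed end, \<open>M n\<close> consists of the permutations with their
  maximum at that end, and \<open>G n\<close> is their weighted sum. In the sum for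
  \<open>G (Suc (Suc n))\<close>, permutations outside \<open>M (Suc n)\<close> keep their weight.
  Those inside are \<open>C (Suc n) L\<close>, and the weight gained depends on whether
  \<open>L\<close> is in \<open>M n\<close>.\<close>

lemma attach_max_recurrence:
  fixes C :: "nat \<Rightarrow> nat list \<Rightarrow> nat list" and M :: "nat \<Rightarrow> nat list set"
    and G :: "nat \<Rightarrow> int poly"
  assumes inj: "\<And>m. inj (C m)"
    and M: "M 0 = {}" "\<And>n. M (Suc n) = C (Suc n) ` S132 n"
    and MS: "\<And>n. M n \<subseteq> S132 n"
    and G: "\<And>n. G (Suc n) = (\<Sum>L\<in>S132 n. weight (C (Suc n) L))" "G 0 = 0"
    and box0: "\<And>n L. L \<in> S132 n - M n \<Longrightarrow> box (C (Suc n) L) = box L"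
    and box1: "\<And>n L. L \<in> M n \<Longrightarrow>
      box (C (Suc (Suc n)) (C (Suc n) L)) = Suc (box (C (Suc n) L))"
    and box2: "\<And>n L. L \<in> S132 n - M n \<Longrightarrow>
      box (C (Suc (Suc n)) (C (Suc n) L)) = box L + 2"
  shows "G (Suc (Suc n)) =
    A_poly (Suc n) + ([:0, 1:] - 1) * G (Suc n) + ([:0, 1:]^2 - [:0, 1:]) * (A_poly n - G n)"
proof -
  let ?x = "[:0, 1:] :: int poly"
  have split: "(\<Sum>L\<in>S132 k. f L) = (\<Sum>L\<in>S132 k - M k. f L) + (\<Sum>L\<in>M k. f L)"
    for k and f :: "nat list \<Rightarrow> int poly"
    using sum.subset_diff[OF MS finite_S132] .
  have GM: "G k = (\<Sum>L\<in>M k. weight L)" for k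
    by (cases k) (simp_all add: G M sum.reindex inj_on_subset[OF inj])
  have rest: "(\<Sum>L\<in>S132 k - M k. weight L) = A_poly k - G k" for k
    using split[where f = weight and k = k] by (simp add: A_poly_eq GM)
  have rest': "(\<Sum>L\<in>S132 k - M k. weight (C (Suc k) L)) = A_poly k - G k" for k
    using rest[of k] by (simp add: box0)
  \<comment> \<open>\<open>G (Suc n)\<close> sums over all of \<open>S132 n\<close>; the part
    outside \<open>M n\<close> has unchanged weights and is subtracted.\<close>
  have GMS: "(\<Sum>L\<in>M n. weight (C (Suc n) L)) = G (Suc n) - (A_poly n - G n)"
    using split[where f = "\<lambda>L. weight (C (Suc n) L)" and k = n] by (simp add: G rest')
  have "G (Suc (Suc n)) = (A_poly (Suc n) - G (Suc n))
      + (\<Sum>L\<in>S132 n. weight (C (Suc (Suc n)) (C (Suc n) L)))"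
    unfolding G(1)[of "Suc n"] split[where k = "Suc n"] rest'
    by (simp add: M sum.reindex inj_on_subset[OF inj])
  also have "(\<Sum>L\<in>S132 n. weight (C (Suc (Suc n)) (C (Suc n) L)))
      = (\<Sum>L\<in>S132 n - M n. ?x^2 * weight L) + (\<Sum>L\<in>M n. ?x * weight (C (Suc n) L))"
    unfolding split[where k = n]
    by (intro arg_cong2[where f = "(+)"] sum.cong refl)
       (simp_all add: box1 box2 power_add power2_eq_square mult.commute del: mult_pCons_left mult_pCons_right)
  also have "\<dots> = ?x^2 * (A_poly n - G n) + ?x * (G (Suc n) - (A_poly n - G n))"
    by (simp only: sum_distrib_left[symmetric] rest GMS)
  finally show ?thesis
    by (simp only: algebra_simps)
qed

lemma not_adj_max:
  assumes "\<sigma> \<in> S132 n" "a \<in> set \<sigma>" "a \<noteq> n"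
  shows "\<not> adj a (Suc n)"
  using assms by (auto simp: S132_iff adj_def)

text \<open>Only \<open>n\<close> could be adjacent in value to \<open>Suc n\<close>, so the seam is
  free of adjacencies. In the second equation the two new maxima form a block that contributes 2 by
  itself.\<close>

lemma box_snoc_max:
  assumes "\<sigma> \<in> S132 n" "\<sigma> = [] \<or> last \<sigma> \<noteq> n"
  shows "box (\<sigma> @ [Suc n]) = box \<sigma>" "box (\<sigma> @ [Suc n, Suc (Suc n)]) = box \<sigma> + 2"
proof -
  have "\<sigma> = [] \<or> \<not> adj (last \<sigma>) (Suc n)"
    using not_adj_max[OF assms(1)] assms(2) by auto
  then show "box (\<sigma> @ [Suc n]) = box \<sigma>" "box (\<sigma> @ [Suc n, Suc (Suc n)]) = box \<sigma> + 2"
    by (subst box_append; simp add: box_pair)+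
qed

lemma box_Cons_max:
  assumes "\<sigma> \<in> S132 n" "\<sigma> = [] \<or> hd \<sigma> \<noteq> n"
  shows "box (Suc n # \<sigma>) = box \<sigma>" "box (Suc (Suc n) # Suc n # \<sigma>) = box \<sigma> + 2"
proof -
  have *: "\<sigma> = [] \<or> \<not> adj (Suc n) (hd \<sigma>)"
    using not_adj_max[OF assms(1)] assms(2) adj_commute by auto
  then show "box (Suc n # \<sigma>) = box \<sigma>"
    using box_append[of "[Suc n]" \<sigma>] by simp
  show "box (Suc (Suc n) # Suc n # \<sigma>) = box \<sigma> + 2"
    using * box_append[of "[Suc (Suc n), Suc n]" \<sigma>] by (simp add: box_pair)
qed

lemma E_poly_recurrence:
  "E_poly (Suc (Suc n)) = A_poly (Suc n) + ([:0, 1:] - 1) * E_poly (Suc n)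
     + ([:0, 1:]^2 - [:0, 1:]) * (A_poly n - (if n = 0 then 0 else E_poly n))"
proof -
  \<comment> \<open>\<open>last []\<close> is unspecified, so index 0 is fixed by hand: the empty
    permutation counts as having no maximum at its end, in accordance with
    \<open>box_snoc_max\<close>.\<close>
  define M where "M n = (if n = 0 then {} else {\<sigma> \<in> S132 n. last \<sigma> = n})" for n
  define G where "G n = (if n = 0 then 0 else E_poly n)" for n
  have M_Suc: "M (Suc n) = (\<lambda>L. L @ [Suc n]) ` S132 n" for n
    unfolding M_def S132_last_max by simp
  have notM: "L = [] \<or> last L \<noteq> n" if "L \<in> S132 n - M n" for L n
    using that by (auto simp: M_def split: if_splits)
  have "G (Suc (Suc n)) = A_poly (Suc n) + ([:0, 1:] - 1) * G (Suc n)
      + ([:0, 1:]^2 - [:0, 1:]) * (A_poly n - G n)"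
  proof (rule attach_max_recurrence[where C = "\<lambda>m L. L @ [m]" and M = M])
    fix n L assume "L \<in> M n"
    then show "box ((L @ [Suc n]) @ [Suc (Suc n)]) = Suc (box (L @ [Suc n]))"
    proof (cases n)
      case (Suc m)
      with \<open>L \<in> M n\<close> obtain L' where "L = L' @ [Suc m]" by (auto simp: M_Suc)
      with Suc show ?thesis using box_snoc_adj[of "Suc m" "Suc (Suc m)" _ L'] by simp
    qed (simp add: M_def)
  next
    show "M n \<subseteq> S132 n" for n by (auto simp: M_def)
  qed (use notM box_snoc_max in \<open>auto simp: inj_on_def M_Suc G_def E_poly_Suc M_def[of 0]\<close>)
  then show ?thesis by (simp add: G_def)
qed

lemma B_poly_recurrence:
  "B_poly (Suc (Suc n)) = A_poly (Suc n) + ([:0, 1:] - 1) * B_poly (Suc n)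
     + ([:0, 1:]^2 - [:0, 1:]) * (A_poly n - (if n = 0 then 0 else B_poly n))"
proof -
  define M where "M n = (if n = 0 then {} else {\<sigma> \<in> S132 n. hd \<sigma> = n})" for n
  define G where "G n = (if n = 0 then 0 else B_poly n)" for n
  have M_Suc: "M (Suc n) = (#) (Suc n) ` S132 n" for n
    unfolding M_def S132_hd_max by simp
  have notM: "L = [] \<or> hd L \<noteq> n" if "L \<in> S132 n - M n" for L n
    using that by (auto simp: M_def split: if_splits)
  have "G (Suc (Suc n)) = A_poly (Suc n) + ([:0, 1:] - 1) * G (Suc n)
      + ([:0, 1:]^2 - [:0, 1:]) * (A_poly n - G n)"
  proof (rule attach_max_recurrence[where C = "(#)" and M = M])
    fix n L assume "L \<in> M n"
    then show "box (Suc (Suc n) # Suc n # L) = Suc (box (Suc n # L))"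
    proof (cases n)
      case (Suc m)
      with \<open>L \<in> M n\<close> obtain L' where "L = Suc m # L'" by (auto simp: M_Suc)
      with Suc show ?thesis by (simp add: box_Cons_adj)
    qed (simp add: M_def)
  next
    show "M n \<subseteq> S132 n" for n by (auto simp: M_def)
  qed (use notM box_Cons_max in \<open>auto simp: inj_on_def M_Suc G_def B_poly_Suc M_def[of 0]\<close>)
  then show ?thesis by (simp add: G_def)
qed

text \<open>Both sequences satisfy the same recurrence of order two and start with the weight of the
  one-entry permutation.\<close>

lemma B_poly_eq_E_poly: "B_poly (Suc n) = E_poly (Suc n)"
proof (induction n rule: less_induct)
  case (less n)
  show ?case
  proof (cases n)
    case 0
    then show ?thesis by (simp add: B_poly_Suc E_poly_Suc)
  next
    case (Suc m)
    have "(if m = 0 then 0 else B_poly m) = (if m = 0 then 0 else E_poly m)"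
      using less.IH Suc by (cases m) auto
    with Suc less.IH[of m] show ?thesis
      unfolding Suc B_poly_recurrence E_poly_recurrence by simp
  qed
qed

section \<open>Splitting at the maximum\<close>

lemma separated_partition:
  assumes "A \<union> B = {1..n}" "\<forall>a\<in>A. \<forall>b\<in>B. b < (a::nat)"
  shows "\<exists>k\<le>n. A = {n - k + 1..n} \<and> B = {1..n - k}"
proof -
  have fin: "finite B" using assms(1) by (metis finite_Un finite_atLeastAtMost)
  \<comment> \<open>The value 0 for empty \<open>B\<close> makes {1..m} the right interval in this
    case too. Any i \<le> m from \<open>A\<close> would have to exceed \<open>m\<close>, so {1..m}
    lies in \<open>B\<close>.\<close>
  define m where "m = (if B = {} then 0 else Max B)"
  have "m \<le> n" "\<forall>b\<in>B. b \<le> m" "m = 0 \<or> m \<in> B"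
    using fin assms(1) Max_in[OF fin] by (auto simp: m_def)
  moreover have "B = {1..m}"
  proof
    show "B \<subseteq> {1..m}" using calculation(2) assms(1) by auto
    show "{1..m} \<subseteq> B"
    proof
      fix i assume i: "i \<in> {1..m}"
      with calculation have "m \<in> B" "i \<in> A \<union> B" unfolding assms(1) by auto
      with i assms(2) show "i \<in> B" by force
    qed
  qed
  moreover have "A = {m + 1..n}"
  proof (cases "m = 0")
    case True
    with assms(1) \<open>B = {1..m}\<close> show ?thesis by simp
  next
    case False
    with \<open>m = 0 \<or> m \<in> B\<close> assms(2) have "\<forall>a\<in>A. m < a" by auto
    then have "A \<inter> B = {}" using \<open>B = {1..m}\<close> by auto
    then have "A = {1..n} - {1..m}" using assms(1) \<open>B = {1..m}\<close> by auto
    then show ?thesis by auto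
  qed
  ultimately show ?thesis by (intro exI[of _ "n - m"]) auto
qed

lemma shift_image: "k \<le> n \<Longrightarrow> (+) (n - k) ` {1..k} = {n - k + 1..(n::nat)}"
  using image_add_atLeastAtMost[of "n - k" 1 k] by (simp only: le_add_diff_inverse add.commute)

lemma S132_unshift:
  assumes "set L = {n - k + 1..n}" "distinct L" "avoids132 L" "k \<le> n"
  shows "\<exists>L'\<in>S132 k. L = map ((+) (n - k)) L'"
proof -
  \<comment> \<open>Truncated subtraction loses nothing here, since every entry of \<open>L\<close>
    exceeds \<open>n - k\<close>.\<close>
  let ?L = "map (\<lambda>x. x - (n - k)) L"
  have "map ((+) (n - k)) ?L = L"
    using assms(1) by (auto intro: map_idI)
  then have L: "L = map ((+) (n - k)) ?L" ..
  have "set L = (+) (n - k) ` {1..k}"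
    using assms(1) shift_image[OF assms(4)] by (simp only:)
  then have "set ?L = (\<lambda>x. x - (n - k)) ` (+) (n - k) ` {1..k}"
    by (simp only: set_map)
  then have "set ?L = {1..k}"
    by (simp only: image_image add_diff_cancel_left' image_ident)
  moreover have "distinct (map ((+) (n - k)) ?L)" "avoids132 (map ((+) (n - k)) ?L)"
    by (simp_all only: L[symmetric] assms(2,3))
  then have "distinct ?L" "avoids132 ?L"
    by (simp only: distinct_map, simp only: avoids132_map_add)
  ultimately have "?L \<in> S132 k" by (simp only: S132_iff)
  with L show ?thesis by (rule bexI)
qed

text \<open>Here \<open>k\<close> is the number of entries before the maximum. The left part is
  stored as a permutation of {1..k} and raised by \<open>n - k\<close>, so that it lies just above
  the values of \<open>R\<close>.\<close>

definition join :: "nat \<Rightarrow> nat \<times> nat list \<times> nat list \<Rightarrow> nat list" where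
  "join n = (\<lambda>(k, L, R). map ((+) (n - k)) L @ Suc n # R)"

lemma join_bij:
  "bij_betw (join n) (SIGMA k:{..n}. S132 k \<times> S132 (n - k)) (S132 (Suc n))"
  (is "bij_betw _ ?D _")
proof (rule bij_betw_imageI)
  show "inj_on (join n) ?D"
  proof (rule inj_onI, clarsimp simp: join_def)
    fix k L R k' L' R'
    assume a: "k \<le> n" "k' \<le> n" "L \<in> S132 k" "R \<in> S132 (n - k)" "L' \<in> S132 k'"
      "R' \<in> S132 (n - k')"
      and eq: "map ((+) (n - k)) L @ Suc n # R = map ((+) (n - k')) L' @ Suc n # R'"
    have "Suc n \<notin> set (map ((+) (n - k)) L)" "Suc n \<notin> set R"
      using a by (auto simp: S132_iff)
    \<comment> \<open>The maximum occurs only once, so it marks the cut; the length of the left part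
      then recovers \<open>k\<close>.\<close>
    with eq have *: "map ((+) (n - k)) L = map ((+) (n - k')) L'" "R = R'"
      by (simp_all add: append_Cons_eq_iff)
    then have "k = k'" using a S132_length by (metis length_map)
    with * show "k = k' \<and> L = L' \<and> R = R'" by (simp add: inj_map_eq_map)
  qed
  show "join n ` ?D = S132 (Suc n)"
  proof (intro equalityI subsetI)
    fix \<sigma> assume "\<sigma> \<in> join n ` ?D"
    then obtain k L R where k: "k \<le> n" "L \<in> S132 k" "R \<in> S132 (n - k)"
      and \<sigma>: "\<sigma> = map ((+) (n - k)) L @ Suc n # R"
      by (auto simp: join_def)
    have set_L: "set (map ((+) (n - k)) L) = {n - k + 1..n}"
      using k(2) shift_image[OF k(1)] by (simp only: S132_iff set_map)
    have set_R: "set R = {1..n - k}" using k by (simp add: S132_iff)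
    have "avoids132 \<sigma>" unfolding \<sigma>
      by (subst avoids132_split_max; unfold set_L set_R) (use k in \<open>auto simp: S132_iff\<close>)
    moreover have "set \<sigma> = {1..Suc n}" unfolding \<sigma> set_append list.set set_L set_R
      using k by auto
    moreover have "distinct \<sigma>" unfolding \<sigma> distinct_append distinct.simps list.set set_L set_R
      using k by (auto simp: S132_iff distinct_map)
    ultimately show "\<sigma> \<in> S132 (Suc n)" by (simp add: S132_iff)
  next
    fix \<sigma> assume \<sigma>: "\<sigma> \<in> S132 (Suc n)"
    then have "Suc n \<in> set \<sigma>" by (simp add: S132_iff)
    then obtain L R where LR: "\<sigma> = L @ Suc n # R" by (meson split_list)
    have dist: "distinct (L @ Suc n # R)" using \<sigma> by (simp add: S132_iff LR)
    have "insert (Suc n) (set L \<union> set R) = {1..Suc n}"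
      using \<sigma> by (simp only: S132_iff LR set_append list.set Un_insert_right)
    moreover have "Suc n \<notin> set L \<union> set R" using dist by simp
    ultimately have un: "set L \<union> set R = {1..n}" by (rule set_insert_maxD)
    have "\<forall>x\<in>set L \<union> set R. x < Suc n" unfolding un by auto
    moreover have "avoids132 (L @ Suc n # R)" using \<sigma> unfolding S132_iff LR by blast
    ultimately have av: "avoids132 L" "avoids132 R" "\<forall>x\<in>set L. \<forall>y\<in>set R. y \<le> x"
      using avoids132_split_max[of L "Suc n" R] by blast+
    \<comment> \<open>Distinctness makes the weak inequality strict, so the two value sets are
      complementary intervals.\<close>
    have "\<forall>x\<in>set L. \<forall>y\<in>set R. y < x"
      using av(3) dist by (fastforce simp: order_less_le)
    then obtain k where k: "k \<le> n" "set L = {n - k + 1..n}" "set R = {1..n - k}"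
      using separated_partition[OF un] by blast
    then obtain L' where "L' \<in> S132 k" "L = map ((+) (n - k)) L'"
      using S132_unshift[OF k(2) _ av(1) k(1)] dist by auto
    moreover have "R \<in> S132 (n - k)"
      using k(3) av(2) dist by (simp add: S132_iff)
    ultimately show "\<sigma> \<in> join n ` ?D"
      using k(1) by (intro image_eqI[of _ _ "(k, L', R)"]) (simp_all add: LR join_def)
  qed
qed

text \<open>For 0 < k the entries of \<open>R\<close> are at most \<open>n - k\<close>, hence below
  \<open>n\<close>, and the seam after \<open>Suc n\<close> carries no adjacency. The left part
  together with the maximum is a shift of \<open>L @ [Suc k]\<close>, and shifts preserve
  \<open>box\<close>.\<close>

lemma box_join:
  assumes "L \<in> S132 k" "R \<in> S132 (n - k)" "0 < k" "k \<le> n"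
  shows "box (join n (k, L, R)) = box (L @ [Suc k]) + box R"
proof -
  have "R = [] \<or> \<not> adj (Suc n) (hd R)"
    using assms hd_in_set[of R] by (auto simp: S132_iff adj_def)
  then have "box ((map ((+) (n - k)) L @ [Suc n]) @ R)
      = box (map ((+) (n - k)) L @ [Suc n]) + box R"
    by (intro box_append) auto
  also have "map ((+) (n - k)) L @ [Suc n] = map ((+) (n - k)) (L @ [Suc k])"
    using assms by simp
  also have "map ((+) (n - k)) (L @ [Suc k]) @ R = join n (k, L, R)"
    using assms by (simp add: join_def)
  finally show ?thesis by (simp only: box_map_add)
qed

text \<open>The case k = 0 of the splitting gives permutations starting with their maximum, hence
  \<open>B_poly\<close>; every other k gives a product by \<open>box_join\<close>.\<close>

lemma A_poly_recurrence:
  "A_poly (Suc n) = B_poly (Suc n) - A_poly n + (\<Sum>k\<le>n. E_poly (Suc k) * A_poly (n - k))"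
proof -
  define h where "h k = (\<Sum>(L, R)\<in>S132 k \<times> S132 (n - k). weight (join n (k, L, R)))" for k
  have "A_poly (Suc n) = (\<Sum>p\<in>(SIGMA k:{..n}. S132 k \<times> S132 (n - k)). weight (join n p))"
    unfolding A_poly_eq by (rule sum.reindex_bij_betw[OF join_bij, symmetric])
  also have "\<dots> = (\<Sum>k\<le>n. h k)"
    unfolding h_def by (subst sum.Sigma) (auto simp: case_prod_unfold)
  also have "\<dots> = h 0 + (\<Sum>k\<in>{1..n}. h k)"
    by (simp add: atMost_atLeast0 sum.atLeast_Suc_atMost)
  also have "h 0 = B_poly (Suc n)"
    by (simp add: h_def join_def B_poly_Suc sum.cartesian_product[symmetric])
  also have "(\<Sum>k\<in>{1..n}. h k) = (\<Sum>k\<in>{1..n}. E_poly (Suc k) * A_poly (n - k))"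
  proof (intro sum.cong refl)
    fix k assume "k \<in> {1..n}"
    then have "h k = (\<Sum>(L, R)\<in>S132 k \<times> S132 (n - k). weight (L @ [Suc k]) * weight R)"
      unfolding h_def by (intro sum.cong refl) (auto simp: box_join power_add)
    then show "h k = E_poly (Suc k) * A_poly (n - k)"
      by (simp add: E_poly_Suc A_poly_eq sum_product sum.cartesian_product)
  qed
  \<comment> \<open>The sum is extended to k = 0 to become a Cauchy product; the added term is
    \<open>A_poly n\<close>, because \<open>E_poly 1\<close> is 1.\<close>
  also have "\<dots> = (\<Sum>k\<le>n. E_poly (Suc k) * A_poly (n - k)) - A_poly n"
    by (simp add: atMost_atLeast0 sum.atLeast_Suc_atMost E_poly_Suc)
  finally show ?thesis by simp
qed

section \<open>Generating functions\<close>

lemma to_fract_sum: "to_fract (sum f S) = (\<Sum>i\<in>S. to_fract (f i))"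
  by (induction S rule: infinite_finite_induct) auto

lemma B_gf_eq_E_gf: "B_gf = E_gf"
  by (auto simp: fps_eq_iff B_gf_def E_gf_def gr0_conv_Suc B_poly_eq_E_poly)

lemma E_gf_equation: "((1 + T)*(1 - X*T) + X^2*T^2) * E_gf = (T*(1 - X*T) + X^2*T^2) * A_gf"
proof -
  let ?x = "to_fract [:0, 1:]"
  have E: "E_gf $ 0 = 0" "E_gf $ Suc n = to_fract (E_poly (Suc n))" for n
    by (simp_all add: E_gf_def)
  have A: "A_gf $ n = to_fract (A_poly n)" for n
    by (simp add: A_gf_def)
  \<comment> \<open>This is the recurrence in terms of series. It applies from index 2 on, so
    coefficients 0 and 1 are checked directly; the zero constant term of \<open>E_gf\<close> matches
    its convention at index 0. Collecting \<open>E_gf\<close> on one side then gives the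
    claim.\<close>
  have "E_gf = T * A_gf + T * (fps_const (?x - 1) * E_gf)
      + T^2 * (fps_const (?x^2 - ?x) * (A_gf - E_gf))" (is "_ = ?r")
  proof (rule fps_ext)
    fix n
    consider "n = 0" | "n = 1" | m where "n = Suc (Suc m)"
      by (metis One_nat_def old.nat.exhaust)
    then show "E_gf $ n = ?r $ n"
    proof cases
      case 1
      then show ?thesis by (simp add: E)
    next
      case 2
      then show ?thesis
        by (simp add: E A fps_X_power_mult_nth E_poly_Suc A_poly_eq E(2)[of 0, simplified])
    next
      case 3
      have "E_gf $ m = to_fract (if m = 0 then 0 else E_poly m)"
        by (simp add: E_gf_def)
      moreover have "to_fract ([:0, 1:]^2 :: int poly) = ?x^2"
        by (simp add: power2_eq_square del: mult_pCons_left mult_pCons_right flip: to_fract_mult)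
      ultimately show ?thesis
        unfolding 3 E(2)[of "Suc m"] E_poly_recurrence
        by (simp add: E A fps_X_power_mult_nth to_fract_mult to_fract_diff
              del: mult_pCons_left mult_pCons_right)
    qed
  qed
  also have "\<dots> = T * A_gf + T * ((X - 1) * E_gf) + T^2 * ((X^2 - X) * (A_gf - E_gf))"
    by (simp add: X_def fps_const_power flip: fps_const_sub)
  finally show ?thesis by algebra
qed

lemma A_gf_equation: "A_gf = 1 + B_gf + (E_gf - T) * A_gf"
proof (rule fps_ext)
  fix n
  show "A_gf $ n = (1 + B_gf + (E_gf - T) * A_gf) $ n"
  proof (cases n)
    case 0
    then show ?thesis by (simp add: A_gf_def B_gf_def E_gf_def A_poly_def)
  next
    case (Suc m)
    \<comment> \<open>The term of index 0 vanishes with the constant term of \<open>E_gf\<close>,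
      which shifts the summation by one.\<close>
    have "(E_gf * A_gf) $ Suc m = (\<Sum>k\<le>m. to_fract (E_poly (Suc k)) * to_fract (A_poly (m - k)))"
      by (simp add: fps_mult_nth sum.atLeast0_atMost_Suc_shift E_gf_def A_gf_def atMost_atLeast0
          del: sum.atMost_Suc sum.cl_ivl_Suc)
    then show ?thesis
      unfolding Suc
      by (simp add: A_gf_def[THEN arg_cong, of "\<lambda>f. f $ _"] B_gf_def A_poly_recurrence
          to_fract_sum to_fract_mult to_fract_diff algebra_simps)
  qed
qed

theorem theorem1:
  "A_gf = (1 + T + T^2 - T*X - T^2*X - T^3*X + T^3*X^2 - fps_sqrt F_gf)
            / (2 * (T*(1 - X*T) + X^2*T^2))
   \<and> B_gf = E_gf
   \<and> E_gf = (T*(1 - X*T) + X^2*T^2) / ((1 + T)*(1 - X*T) + X^2*T^2) * A_gf"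
proof -
  define N where "N = T*(1 - X*T) + X^2*T^2"
  define D where "D = (1 + T)*(1 - X*T) + X^2*T^2"
  define P where "P = 1 + T + T^2 - T*X - T^2*X - T^3*X + T^3*X^2"
  have D0: "D $ 0 = 1" by (simp add: D_def X_def)
  then have Dn: "D \<noteq> 0" by auto
  have "N $ 1 = 1"
    by (simp add: N_def X_def fps_X_power_mult_right_nth)
  then have Nn: "N \<noteq> 0" by auto
  have DE: "D * E_gf = N * A_gf"
    using E_gf_equation by (simp add: D_def N_def)
  \<comment> \<open>Multiplying by \<open>D\<close> allows \<open>B_gf\<close> and
    \<open>E_gf\<close> to be eliminated through \<open>DE\<close>.\<close>
  have "D * A_gf = D + D * E_gf + (D * E_gf - D * T) * A_gf"
    using A_gf_equation B_gf_eq_E_gf by algebra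
  then have "D * A_gf = D + N * A_gf + (N * A_gf - D * T) * A_gf"
    by (simp only: DE)
  moreover have "P = D + T * D - N"
    unfolding P_def D_def N_def by algebra
  ultimately have quad: "N * A_gf^2 - P * A_gf + D = 0"
    by algebra
  \<comment> \<open>Completing the square in the quadratic equation: up to sign this is the
    derivative of the quadratic at \<open>A_gf\<close>, so its square is the discriminant.\<close>
  let ?s = "P - 2 * N * A_gf"
  have "?s^2 = P^2 - 4 * D * N"
    using quad by algebra
  \<comment> \<open>The branch is forced because \<open>N\<close> has constant term 0 and
    \<open>P\<close> has constant term 1.\<close>
  then have "?s = fps_sqrt F_gf"
    by (intro fps_sqrt_F_branch[where a = A_gf]) (simp_all add: F_gf_def P_def N_def D_def)
  then have "2 * N * A_gf = P - fps_sqrt F_gf"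
    by (simp add: algebra_simps)
  \<comment> \<open>\<open>2 * N\<close> is not a unit, but the numerator is a multiple of it and it
    is nonzero, so the quotient is exact.\<close>
  then have "A_gf = (P - fps_sqrt F_gf) / (2 * N)"
    using Nn by (metis nonzero_mult_div_cancel_left mult_eq_0_iff zero_neq_numeral)
  moreover have "E_gf = N / D * A_gf"
  proof -
    \<comment> \<open>\<open>D\<close> has constant term 1 and is therefore a unit.\<close>
    have "D * (N / D) = N"
      using D0 by (intro dvd_mult_div_cancel) (simp add: fps_is_unit_iff unit_imp_dvd)
    then have "D * E_gf = D * (N / D * A_gf)"
      using DE by (metis mult.assoc)
    with Dn show ?thesis by simp
  qed
  ultimately show ?thesis
    using B_gf_eq_E_gf by (simp add: P_def N_def D_def)
qed

end
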